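(* Let $N\ge1$, let $\mathcal{V}$ be a finite set, and let $\mathbf{X}=(X_1,\dots,X_N)$ be the coordinate sequence on $\mathcal{V}^N$ under the probability measure $\mathbb{P}$ induced by transition kernels $\{p_i\}_{i=1}^N$. Suppose the causal interdependence matrix $H$ of $\{p_i\}_{i=1}^N$ satisfies $$\|H\|_1=\max_{1\le j\le N}\sum_{i=1}^{j-1}H_{i,j}\le\alpha$$ for a constant $\alpha\in(0,1)$. Let $f:\mathcal{V}^N\to\mathbb{R}$ be a function depending only on the final coordinate, with sensitivity vector $\mathbf{c}=(0,\dots,0,c_N)^\top$, i.e. $|f(x)-f(y)|\le c_N\mathbf{1}_{\{x_N\neq y_N\}}$ for all $x,y\in\mathcal{V}^N$. Then for every $t>0$, $$\mathbb{P}\bigl(|f(\mathbf{X})-\mathbb{E}[f(\mathbf{X})]|\ge t\bigr)\le 2\exp\left(-\frac{2t^2(1-\alpha)^2}{c_N^2}\right).$$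
   Context: Setting. For each $i\in\{1,\dots,N\}$ and each history $x_{1:i-1}=(x_1,\dots,x_{i-1})\in\mathcal{V}^{i-1}$, $p_i(\cdot\mid x_{1:i-1})$ is a probability measure on the finite set $\mathcal{V}$ (kernels are specified for all histories; for $i=1$ the history is empty). The measure $\mathbb{P}$ on $\mathcal{V}^N$ is defined by $\mathbb{P}(X_{1:N}=x_{1:N})=\prod_{i=1}^N p_i(x_i\mid x_{1:i-1})$, where $X_i(x)=x_i$ are the coordinate projections. Total variation distance on $\mathcal{V}$: $d_{\mathrm{TV}}(\mu,\nu)=\frac12\sum_{a\in\mathcal{V}}|\mu(a)-\nu(a)|$. Causal interdependence matrix $H\in\mathbb{R}^{N\times N}$: $H_{i,j}=0$ for $i\ge j$, and for $1\le i<j\le N$, $$H_{i,j}=\max_{\mathbf{z}\in\mathcal{V}^{i-1},\ x,x'\in\mathcal{V},\ \mathbf{w}\in\mathcal{V}^{j-i-1}} d_{\mathrm{TV}}\bigl(p_j(\cdot\mid\mathbf{z},x,\mathbf{w}),\,p_j(\cdot\mid\mathbf{z},x',\mathbf{w})\bigr).$$ Convention: if $c_N=0$, the right-hand side is read as $0$. *)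

theory Defs
  imports "HOL-Probability.Probability"
begin

text \<open>The finite set \<open>\<V>\<close> is a type \<open>'v\<close> of class \<^class>\<open>finite\<close>, and elements of \<open>\<V>\<^sup>N\<close> are lists of
  length \<open>N\<close>.  Coordinates and kernels are numbered from 1, list positions from 0: the coordinate
  \<open>x\<^sub>i\<close> is \<open>xs ! (i - 1)\<close> and the history \<open>x\<^sub>1, \<dots>, x\<^sub>i\<^sub>-\<^sub>1\<close> is \<open>take (i - 1) xs\<close>.  The kernel \<open>p i\<close> is only
  ever applied to histories of length \<open>i - 1\<close>.\<close>

type_synonym 'v kernels = "nat \<Rightarrow> 'v list \<Rightarrow> 'v pmf"

definition seqs :: "nat \<Rightarrow> 'v list set" where
  "seqs n = {xs. length xs = n}"

definition coord :: "nat \<Rightarrow> 'v list \<Rightarrow> 'v" where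
  "coord i xs = xs ! (i - 1)"

definition induced_measure :: "nat \<Rightarrow> 'v::finite kernels \<Rightarrow> 'v list measure" where
  "induced_measure N p =
     point_measure (seqs N)
       (\<lambda>xs. ennreal (\<Prod>i = 1..N. pmf (p i (take (i - 1) xs)) (coord i xs)))"

definition tv_dist :: "'v::finite pmf \<Rightarrow> 'v pmf \<Rightarrow> real" where
  "tv_dist \<mu> \<nu> = 1 / 2 * (\<Sum>a\<in>UNIV. \<bar>pmf \<mu> a - pmf \<nu> a\<bar>)"

text \<open>\<open>N \<times> N\<close> matrices are functions on pairs of indices in \<open>{1..N}\<close>.  The set below is finite and
  nonempty, so \<^const>\<open>Max\<close> is a genuine maximum.\<close>

definition interdependence :: "'v::finite kernels \<Rightarrow> nat \<Rightarrow> nat \<Rightarrow> real" where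
  "interdependence p i j =
     (if i \<ge> j then 0
      else Max {tv_dist (p j (z @ [x] @ w)) (p j (z @ [x'] @ w)) | z x x' w.
                  z \<in> seqs (i - 1) \<and> w \<in> seqs (j - i - 1)})"

text \<open>This is the operator 1-norm (maximal absolute column sum) of \<open>H\<close>, see
  \<open>interdependence_norm1_eq\<close> below.\<close>

definition interdependence_norm1 :: "nat \<Rightarrow> 'v::finite kernels \<Rightarrow> real" where
  "interdependence_norm1 N p = Max ((\<lambda>j. \<Sum>i = 1..<j. interdependence p i j) ` {1..N})"

lemma finite_seqs [simp]: "finite (seqs n :: 'v::finite list set)"
  using finite_lists_length_eq[of "UNIV :: 'v set" n] by (simp add: seqs_def)

lemma interdependence_nonneg:
  fixes p :: "'v::finite kernels"
  shows "0 \<le> interdependence p i j"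
proof (cases "i \<ge> j")
  case False
  let ?g = "\<lambda>(z, x, x', w). tv_dist (p j (z @ [x] @ w)) (p j (z @ [x'] @ w))"
  let ?D = "(seqs (i - 1) :: 'v list set) \<times> (UNIV :: 'v set) \<times> (UNIV :: 'v set) \<times> (seqs (j - i - 1) :: 'v list set)"
  have eq: "{tv_dist (p j (z @ [x] @ w)) (p j (z @ [x'] @ w)) | z x x' w.
               z \<in> seqs (i - 1) \<and> w \<in> seqs (j - i - 1)} = ?g ` ?D" (is "?L = _")
  proof (intro set_eqI iffI)
    fix r assume "r \<in> ?L"
    then obtain z x x' w where "r = ?g (z, x, x', w)" "(z, x, x', w) \<in> ?D" by simp blast
    then show "r \<in> ?g ` ?D" by (rule image_eqI)
  next
    fix r assume "r \<in> ?g ` ?D"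
    then obtain q where "q \<in> ?D" "r = ?g q" by (rule imageE)
    then show "r \<in> ?L" by (cases q) (simp, blast)
  qed
  have "replicate n undefined \<in> (seqs n :: 'v list set)" for n
    by (simp add: seqs_def)
  then have "(seqs n :: 'v list set) \<noteq> {}" for n by blast
  then have "?D \<noteq> {}" by (simp add: Sigma_empty_iff del: One_nat_def)
  moreover have "finite (?g ` ?D)" by (intro finite_imageI finite_cartesian_product) simp_all
  ultimately have "Max (?g ` ?D) \<in> ?g ` ?D" by (intro Max_in) simp_all
  moreover have "0 \<le> tv_dist \<mu> \<nu>" for \<mu> \<nu> :: "'v pmf"
    by (simp add: tv_dist_def sum_nonneg)
  ultimately have "0 \<le> Max (?g ` ?D)" by auto
  with False show ?thesis unfolding interdependence_def eq by simp
qed (simp add: interdependence_def)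

lemma interdependence_norm1_eq:
  "interdependence_norm1 N p = Max ((\<lambda>j. \<Sum>i = 1..N. \<bar>interdependence p i j\<bar>) ` {1..N})"
proof -
  have "(\<Sum>i = 1..N. \<bar>interdependence p i j\<bar>) = (\<Sum>i = 1..<j. interdependence p i j)"
    if "j \<in> {1..N}" for j
    using that
    by (intro sum.mono_neutral_cong_right)
       (auto simp: interdependence_nonneg, simp add: interdependence_def)
  then show ?thesis by (simp add: interdependence_norm1_def)
qed

lemma seqs_Suc: "seqs (Suc n) = (\<lambda>(xs, a). xs @ [a]) ` (seqs n \<times> UNIV)"
proof -
  have "ys \<in> (\<lambda>(xs, a). xs @ [a]) ` (seqs n \<times> UNIV)" if "length ys = Suc n" for ys :: "'a list"
  proof -
    have "ys = butlast ys @ [last ys]" "length (butlast ys) = n"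
      using that by (cases ys rule: rev_cases; simp)+
    then show ?thesis by (auto simp: seqs_def intro!: image_eqI[where x = "(butlast ys, last ys)"])
  qed
  then show ?thesis by (auto simp: seqs_def)
qed

lemma sum_kernels_eq_1:
  fixes p :: "'v::finite kernels"
  shows "(\<Sum>xs\<in>seqs N. \<Prod>i = 1..N. pmf (p i (take (i - 1) xs)) (coord i xs)) = 1"
proof (induction N)
  case 0
  show ?case by (simp add: seqs_def)
next
  case (Suc n)
  let ?w = "\<lambda>N xs. \<Prod>i = 1..N. pmf (p i (take (i - 1) xs)) (coord i xs)"
  have inj: "inj_on (\<lambda>(xs, a). xs @ [a]) (seqs n \<times> (UNIV :: 'v set))"
    by (auto simp: inj_on_def)
  have snoc: "?w (Suc n) (xs @ [a]) = ?w n xs * pmf (p (Suc n) xs) a" if "xs \<in> seqs n" for xs a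
  proof -
    have "length xs = n" using that by (simp add: seqs_def)
    moreover from this have "?w n (xs @ [a]) = ?w n xs"
      by (intro prod.cong) (auto simp: coord_def nth_append)
    ultimately show ?thesis by (simp add: coord_def nth_append)
  qed
  have "(\<Sum>xs\<in>seqs (Suc n). ?w (Suc n) xs) = (\<Sum>(xs, a)\<in>seqs n \<times> UNIV. ?w (Suc n) (xs @ [a]))"
    unfolding seqs_Suc by (subst sum.reindex[OF inj]) (simp add: case_prod_unfold)
  also have "\<dots> = (\<Sum>xs\<in>seqs n. \<Sum>a\<in>UNIV. ?w n xs * pmf (p (Suc n) xs) a)"
    by (subst sum.cartesian_product[symmetric]) (intro sum.cong refl snoc)
  also have "\<dots> = (\<Sum>xs\<in>seqs n. ?w n xs)"
    by (simp add: sum_distrib_left[symmetric] sum_pmf_eq_1)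
  finally show ?case using Suc.IH by simp
qed

lemma prob_space_induced_measure: "prob_space (induced_measure N p)"
proof -
  have "(\<Sum>xs\<in>seqs N. ennreal (\<Prod>i = 1..N. pmf (p i (take (i - 1) xs)) (coord i xs))) = 1"
    by (subst sum_ennreal) (simp_all only: sum_kernels_eq_1 prod_nonneg pmf_nonneg ennreal_1)
  then show ?thesis
    unfolding induced_measure_def by (intro prob_space_point_measure) simp_all
qed

end

theory Submission
  imports Defs
begin

text \<open>Only the last coordinate enters \<open>f\<close>, so \<open>f\<close> takes values in an interval of length
  \<open>\<bar>c\<^sub>N\<bar>\<close>. Hoeffding's inequality for this single variable gives the bound without the factor
  \<open>(1 - \<alpha>)\<^sup>2 \<le> 1\<close>, which only weakens it.\<close>

text \<open>The only nonempty subset of \<open>{i}\<close> is \<open>{i}\<close> itself, so the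
  product formula for independence is a trivial identity. This supplies the independence assumption
  of the Hoeffding locale.\<close>

lemma (in prob_space) indep_vars_singleton:
  assumes "X i \<in> measurable M (M' i)"
  shows "indep_vars M' X {i}"
  unfolding indep_vars_def2
proof (intro conjI ballI)
  show "indep_sets (\<lambda>i. {X i -` A \<inter> space M |A. A \<in> sets (M' i)}) {i}"
    using assms by (intro indep_setsI) (auto simp: measurable_sets subset_singleton_iff)
qed (use assms in auto)

lemma (in prob_space) prob_deviation_le_oscillation:
  fixes f :: "'a \<Rightarrow> real"
  assumes f [measurable]: "random_variable borel f"
    and osc: "\<And>x y. x \<in> space M \<Longrightarrow> y \<in> space M \<Longrightarrow> \<bar>f x - f y\<bar> \<le> d"
    and "d > 0" and "t \<ge> 0"
  shows "prob {x \<in> space M. \<bar>f x - expectation f\<bar> \<ge> t} \<le> 2 * exp (- (2 * t\<^sup>2 / d\<^sup>2))"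
proof -
  \<comment> \<open>The interval in Hoeffding's inequality must not depend on the point. Each
    \<open>f x - d\<close> is a lower bound of the range, hence lies below the infimum
    \<open>a\<close>, so all values fall in \<open>{a..a + d}\<close>.\<close>
  define a where "a = Inf (f ` space M)"
  obtain x0 where x0: "x0 \<in> space M" using not_empty by blast
  have bdd: "bdd_below (f ` space M)"
    by (rule bdd_belowI2[where m = "f x0 - d"]) (use osc[OF x0] in \<open>smt (verit)\<close>)
  have range: "f x \<in> {a..a + d}" if x: "x \<in> space M" for x
  proof -
    have "a \<le> f x" unfolding a_def using bdd x by (intro cINF_lower)
    moreover have "f x - d \<le> a" unfolding a_def
      by (intro cINF_greatest not_empty) (use osc[OF x] in \<open>smt (verit)\<close>)
    ultimately show ?thesis by simp
  qed
  \<comment> \<open>With a one-point index set the sum of the variables is \<open>f\<close> and the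
    sum of squared interval lengths is \<open>d\<^sup>2\<close>.\<close>
  interpret Hoeffding_ineq M "{()}" "\<lambda>_. f" "\<lambda>_. a" "\<lambda>_. a + d" "expectation f"
    by unfold_locales (auto intro!: indep_vars_singleton f AE_I2 simp: range[simplified])
  show ?thesis
    using Hoeffding_ineq_abs_ge[OF \<open>t \<ge> 0\<close>] \<open>d > 0\<close> by simp
qed

theorem proposition5p2:
  fixes N :: nat and p :: "'v::finite kernels" and \<alpha> c\<^sub>N t :: real and f :: "'v list \<Rightarrow> real"
  assumes "N \<ge> 1"
    and "0 < \<alpha>" and "\<alpha> < 1"
    and "interdependence_norm1 N p \<le> \<alpha>"
    and "\<And>x y. x \<in> seqs N \<Longrightarrow> y \<in> seqs N \<Longrightarrow>
           \<bar>f x - f y\<bar> \<le> c\<^sub>N * of_bool (coord N x \<noteq> coord N y)"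
    and "t > 0"
  shows "\<P>(x in induced_measure N p.
             \<bar>f x - (\<integral>y. f y \<partial>(induced_measure N p))\<bar> \<ge> t)
         \<le> (if c\<^sub>N = 0 then 0 else 2 * exp (- (2 * t\<^sup>2 * (1 - \<alpha>)\<^sup>2 / c\<^sub>N\<^sup>2)))"
proof -
  let ?M = "induced_measure N p"
  interpret prob_space ?M by (rule prob_space_induced_measure)
  have space: "space ?M = seqs N" by (simp add: induced_measure_def space_point_measure)
  \<comment> \<open>The absolute value covers a one-element alphabet, where the sensitivity bound
    reads 0 \<le> 0 and \<open>c\<^sub>N\<close> may be negative.\<close>
  have osc: "\<bar>f x - f y\<bar> \<le> \<bar>c\<^sub>N\<bar>" if "x \<in> space ?M" "y \<in> space ?M" for x y
    using assms(5)[of x y] that by (auto simp: space of_bool_def split: if_splits)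
  have meas: "random_variable borel f"
    by (simp add: induced_measure_def measurable_point_measure_eq1)
  show ?thesis
  proof (cases "c\<^sub>N = 0")
    case True
    \<comment> \<open>Zero oscillation makes \<open>f\<close> constant and equal to its mean on the
      whole space, so the event is empty for t > 0, matching the convention that the bound is then
      0.\<close>
    obtain x0 where x0: "x0 \<in> space ?M" using not_empty by blast
    have const: "f x = f x0" if "x \<in> space ?M" for x
      using osc[OF that x0] True by simp
    then have "expectation f = expectation (\<lambda>_. f x0)"
      by (intro Bochner_Integration.integral_cong) auto
    then have "expectation f = f x0" by (simp add: prob_space)
    then have "{x \<in> space ?M. \<bar>f x - expectation f\<bar> \<ge> t} = {}"
      using const \<open>t > 0\<close> by auto
    then show ?thesis using True by (simp only: measure_empty) simp
  next
    case False
    have "prob {x \<in> space ?M. \<bar>f x - expectation f\<bar> \<ge> t} \<le> 2 * exp (- (2 * t\<^sup>2 / \<bar>c\<^sub>N\<bar>\<^sup>2))"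
      using False \<open>t > 0\<close> by (intro prob_deviation_le_oscillation meas osc) auto
    also have "\<dots> \<le> 2 * exp (- (2 * t\<^sup>2 * (1 - \<alpha>)\<^sup>2 / c\<^sub>N\<^sup>2))"
    proof -
      have "(1 - \<alpha>)\<^sup>2 \<le> 1" using assms(2,3) by (simp add: power_le_one)
      then have "2 * t\<^sup>2 * (1 - \<alpha>)\<^sup>2 \<le> 2 * t\<^sup>2" by (simp add: mult_left_le)
      then show ?thesis by (simp add: divide_right_mono)
    qed
    finally show ?thesis using False by simp
  qed
qed

end
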